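(* Assume $A$ is associative. Let $\tau,\widetilde\tau\in\{0,\ldots,n\}$ and let $T=(t_0,\ldots,t_\tau)$ and $\widetilde T=(\widetilde t_0,\ldots,\widetilde t_{\widetilde\tau})$ be two lists of steps for $V$. Let $\Omega$ be a domain in $V$. The inclusion $\operatorname{Reg}_T(\Omega,A)\subseteq\operatorname{Reg}_{\widetilde T}(\Omega,A)$ is equivalent to the equality $\operatorname{Reg}_T(\Omega,A)=\operatorname{Reg}_{\widetilde T}(\Omega,A)$ and to the following property: one among the lists $T,\widetilde T$ comprises the other, possibly preceded by some steps of the form $(m,m+1)$; that is, either $\widetilde t_0\le t_0$ and $\widetilde T=(\widetilde t_0,\widetilde t_0+1,\ldots,t_0-1,t_0,t_1,\ldots,t_\tau)$, or $t_0\le\widetilde t_0$ and $T=(t_0,t_0+1,\ldots,\widetilde t_0-1,\widetilde t_0,\widetilde t_1,\ldots,\widetilde t_{\widetilde\tau})$.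
   Context: $\mathbb{N}$ includes $0$. $A$ is a finite-dimensional alternative (unital) real $*$-algebra: a finite-dimensional real vector space with an $\mathbb{R}$-bilinear multiplication such that $x(xy)=x^2y$, $(xy)y=xy^2$ (automatic if $A$ is associative), and with an involutive real-linear antiautomorphism $x\mapsto x^c$; $\mathbb{R}$ is identified with $\mathbb{R}1$. Set $t(x)=x+x^c$, $n(x)=xx^c$, $\mathbb{S}_A=\{x\in A:t(x)=0,\ n(x)=1\}$, assumed nonempty. Let $Q_A=\bigcup_{J\in\mathbb{S}_A}(\mathbb{R}+J\mathbb{R})$. A hypercomplex subspace of $A$ is a real vector subspace $V$ with $\mathbb{R}\subsetneq V\subseteq Q_A$; a hypercomplex basis of $V$ is an ordered real basis $(v_0,\ldots,v_n)$ with $n\ge1$, $v_0=1$, $v_s\in\mathbb{S}_A$ and $v_sv_u=-v_uv_s$ for distinct $s,u\in\{1,\ldots,n\}$. Setting. $V$ is a hypercomplex subspace of $A$ with hypercomplex basis $\mathcal{B}=(v_0,\ldots,v_n)$, completed to a real basis $\mathcal{B}'$ of $A$; unit spheres below refer to the Euclidean norm making $\mathcal{B}'$ orthonormal. A domain is a nonempty connected open subset. For $\tau\in\{0,\ldots,n\}$, a list of steps for $V$ is $T=(t_0,\ldots,t_\tau)\in\mathbb{N}^{\tau+1}$ with $0\le t_0<t_1<\cdots<t_\tau=n$. For $0\le\ell\le m\le n$, $\mathbb{R}_{\ell,m}=\mathrm{Span}(v_\ell,\ldots,v_m)$ and $\mathbb{S}_{\ell,m}$ is its unit sphere. The $T$-torus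 is $\mathbb{T}=\mathbb{S}_{t_0+1,t_1}\times\cdots\times\mathbb{S}_{t_{\tau-1}+1,t_\tau}$ if $\tau\ge1$. For $J=(J_1,\ldots,J_\tau)\in\mathbb{T}$, $\mathcal{B}_J=(v_0,v_1,\ldots,v_{t_0},J_1,\ldots,J_\tau)$ and $\mathbb{R}_J^{t_0+\tau+1}=\mathrm{Span}(\mathcal{B}_J)$, with elements written $x_0+v_1x_1+\cdots+v_{t_0}x_{t_0}+\beta_1J_1+\cdots+\beta_\tau J_\tau$. If $\tau=0$, "$J\in\mathbb{T}$" is read as $J=\emptyset$, with $\mathcal{B}_\emptyset=\mathcal{B}$ and $\mathbb{R}_\emptyset^{t_0+1}=V$. For $\Omega\subseteq V$ and $f:\Omega\to A$: $\Omega_J=\Omega\cap\mathbb{R}_J^{t_0+\tau+1}$ and $f_J=f|_{\Omega_J}$. For a domain $\Omega\subseteq V$, $\operatorname{Reg}_T(\Omega,A)$ is the class of $T$-regular functions $f:\Omega\to A$, i.e. those such that for every $J\in\mathbb{T}$ the restriction $f_J$ is of class $\mathscr{C}^1$ on the open subset $\Omega_J$ of $\mathbb{R}_J^{t_0+\tau+1}$ with $(\partial_{x_0}+v_1\partial_{x_1}+\cdots+v_{t_0}\partial_{x_{t_0}}+J_1\partial_{\beta_1}+\cdots+J_\tau\partial_{\beta_\tau})f_J\equiv0$ (vacuous if $\Omega_J=\emptyset$). The same definitions apply to $\widetilde T$. *)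

theory Defs
  imports "HOL-Analysis.Analysis"
begin

text \<open>
  The algebra \<open>A\<close> is a type of sort \<open>{real_algebra_1, euclidean_space}\<close>: the first class supplies
  the unital associative \<open>\<real>\<close>-bilinear product, the second finite dimension and the canonical vector
  space topology.  The two are not related by any compatibility condition, and the inner product
  of the class is used for nothing but its topology (which is the same for every norm on \<open>A\<close>);
  the Euclidean norm attached to a chosen basis is \<open>basis_norm\<close> below.
\<close>

definition star_involution :: "('a::real_algebra_1 \<Rightarrow> 'a) \<Rightarrow> bool" where
  "star_involution c \<longleftrightarrow>
     linear c \<and> (\<forall>x. c (c x) = x) \<and> (\<forall>x y. c (x * y) = c y * c x)"

definition star_trace :: "('a::real_algebra_1 \<Rightarrow> 'a) \<Rightarrow> 'a \<Rightarrow> 'a" where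
  "star_trace c x = x + c x"

definition star_norm :: "('a::real_algebra_1 \<Rightarrow> 'a) \<Rightarrow> 'a \<Rightarrow> 'a" where
  "star_norm c x = x * c x"

definition imag_units :: "('a::real_algebra_1 \<Rightarrow> 'a) \<Rightarrow> 'a set" where
  "imag_units c = {x. star_trace c x = 0 \<and> star_norm c x = 1}"

definition quadratic_cone :: "('a::real_algebra_1 \<Rightarrow> 'a) \<Rightarrow> 'a set" where
  "quadratic_cone c = (\<Union>J\<in>imag_units c. {of_real a + J * of_real b | a b. True})"

definition hypercomplex_subspace :: "('a::real_algebra_1 \<Rightarrow> 'a) \<Rightarrow> 'a set \<Rightarrow> bool" where
  "hypercomplex_subspace c V \<longleftrightarrow> subspace V \<and> \<real> \<subset> V \<and> V \<subseteq> quadratic_cone c"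

text \<open>The ordered basis \<open>(v\<^sub>0, \<dots>, v\<^sub>n)\<close> is a function on \<open>nat\<close>; values beyond \<open>n\<close> are irrelevant.\<close>

definition hypercomplex_basis ::
  "('a::real_algebra_1 \<Rightarrow> 'a) \<Rightarrow> 'a set \<Rightarrow> nat \<Rightarrow> (nat \<Rightarrow> 'a) \<Rightarrow> bool" where
  "hypercomplex_basis c V n v \<longleftrightarrow>
     n \<ge> 1 \<and> inj_on v {0..n} \<and> independent (v ` {0..n}) \<and> span (v ` {0..n}) = V \<and>
     v 0 = 1 \<and> (\<forall>s\<in>{1..n}. v s \<in> imag_units c) \<and>
     (\<forall>s\<in>{1..n}. \<forall>u\<in>{1..n}. s \<noteq> u \<longrightarrow> v s * v u = - (v u * v s))"

definition completes_basis :: "nat \<Rightarrow> (nat \<Rightarrow> 'a::real_vector) \<Rightarrow> 'a set \<Rightarrow> bool" where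
  "completes_basis n v B \<longleftrightarrow> v ` {0..n} \<subseteq> B \<and> independent B \<and> span B = UNIV"

text \<open>The Euclidean norm for which the (finite) basis \<open>B\<close> of \<open>A\<close> is orthonormal.\<close>

definition basis_norm :: "'a::real_vector set \<Rightarrow> 'a \<Rightarrow> real" where
  "basis_norm B x = sqrt (\<Sum>b\<in>B. (representation B x b)\<^sup>2)"

definition list_of_steps :: "nat \<Rightarrow> nat \<Rightarrow> nat list \<Rightarrow> bool" where
  "list_of_steps n \<tau> T \<longleftrightarrow> length T = \<tau> + 1 \<and> sorted_wrt (<) T \<and> T ! \<tau> = n"

definition coord_sphere ::
  "(nat \<Rightarrow> 'a::real_vector) \<Rightarrow> 'a set \<Rightarrow> nat \<Rightarrow> nat \<Rightarrow> 'a set" where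
  "coord_sphere v B l m = {x \<in> span (v ` {l..m}). basis_norm B x = 1}"

text \<open>
  Points of the torus are lists of length \<open>\<tau>\<close>, so \<open>J\<^sub>h\<close> is \<open>J ! (h - 1)\<close>.  For \<open>\<tau> = 0\<close> the torus is
  \<open>{[]}\<close>; then \<open>t\<^sub>0 = n\<close>, so \<open>adapted_basis v T []\<close> is the whole basis and \<open>slice\<close> gives \<open>\<Omega>\<close>.
\<close>

definition torus :: "(nat \<Rightarrow> 'a::real_vector) \<Rightarrow> 'a set \<Rightarrow> nat list \<Rightarrow> 'a list set" where
  "torus v B T = {J. length J = length T - 1 \<and>
     (\<forall>h < length J. J ! h \<in> coord_sphere v B (T ! h + 1) (T ! (h + 1)))}"

definition adapted_basis :: "(nat \<Rightarrow> 'a) \<Rightarrow> nat list \<Rightarrow> 'a list \<Rightarrow> 'a list" where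
  "adapted_basis v T J = map v [0..<T ! 0 + 1] @ J"

definition slice ::
  "(nat \<Rightarrow> 'a::real_vector) \<Rightarrow> nat list \<Rightarrow> 'a list \<Rightarrow> 'a set \<Rightarrow> 'a set" where
  "slice v T J \<Omega> = \<Omega> \<inter> span (set (adapted_basis v T J))"

text \<open>
  The partial derivative with respect to the coordinate belonging to a basis vector \<open>w\<close> of a subspace
  is the derivative along \<open>w\<close>.  A function on a relatively open set \<open>U\<close> of the span of the basis \<open>ws\<close>
  is of class \<open>C\<^sup>1\<close> iff its first order partial derivatives exist and are continuous on \<open>U\<close>.
  Near \<open>0\<close> the line \<open>x + s w\<close> stays in \<open>U\<close>, so only the values of \<open>f\<close> on \<open>U\<close> matter.
\<close>

definition partial_deriv ::
  "('a::real_normed_vector \<Rightarrow> 'b::real_normed_vector) \<Rightarrow> 'a \<Rightarrow> 'a \<Rightarrow> 'b" where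
  "partial_deriv f w x = vector_derivative (\<lambda>s::real. f (x + s *\<^sub>R w)) (at 0)"

definition C1_on ::
  "'a::real_normed_vector list \<Rightarrow> 'a set \<Rightarrow> ('a \<Rightarrow> 'b::real_normed_vector) \<Rightarrow> bool" where
  "C1_on ws U f \<longleftrightarrow> (\<forall>w\<in>set ws.
     (\<forall>x\<in>U. (\<lambda>s::real. f (x + s *\<^sub>R w)) differentiable (at 0)) \<and>
     continuous_on U (partial_deriv f w))"

text \<open>As \<open>v\<^sub>0 = 1\<close>, the first summand is \<open>\<partial>f/\<partial>x\<^sub>0\<close> when \<open>ws\<close> is an adapted basis.\<close>

definition cr_operator ::
  "'a::{real_algebra_1, euclidean_space} list \<Rightarrow> ('a \<Rightarrow> 'a) \<Rightarrow> 'a \<Rightarrow> 'a" where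
  "cr_operator ws f x = (\<Sum>i<length ws. ws ! i * partial_deriv f (ws ! i) x)"

definition domain_in :: "'a::real_normed_vector set \<Rightarrow> 'a set \<Rightarrow> bool" where
  "domain_in V \<Omega> \<longleftrightarrow> \<Omega> \<noteq> {} \<and> connected \<Omega> \<and> openin (top_of_set V) \<Omega>"

text \<open>
  Functions \<open>\<Omega> \<rightarrow> A\<close> are represented by the extensional ones, so that equality of elements of
  \<open>Reg\<close> is equality of functions on \<open>\<Omega>\<close>.
\<close>

definition Reg ::
  "(nat \<Rightarrow> 'a::{real_algebra_1, euclidean_space}) \<Rightarrow> 'a set \<Rightarrow> nat list \<Rightarrow> 'a set \<Rightarrow> ('a \<Rightarrow> 'a) set" where
  "Reg v B T \<Omega> = {f \<in> \<Omega> \<rightarrow>\<^sub>E UNIV. \<forall>J\<in>torus v B T.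
     C1_on (adapted_basis v T J) (slice v T J \<Omega>) f \<and>
     (\<forall>x\<in>slice v T J \<Omega>. cr_operator (adapted_basis v T J) f x = 0)}"

end

theory Submission
  imports Defs
begin

text \<open>
  A list of steps \<open>T\<close> cuts \<open>{1..n}\<close> into consecutive blocks: the singletons \<open>{1}, \<dots>, {t\<^sub>0}\<close> and
  the intervals \<open>{t\<^sub>h + 1..t\<^sub>h\<^sub>+\<^sub>1}\<close>.  A step \<open>(m, m + 1)\<close> in front of the list produces a
  singleton block just as a larger \<open>t\<^sub>0\<close> does, and the theorem amounts to the claim that
  \<open>Reg\<^sub>T\<close> depends on the blocks only and that already an inclusion between two such classes forces the
  blocks to agree.

  One direction is elementary: the sphere of a block \<open>{m + 1}\<close> is \<open>{v\<^sub>m\<^sub>+\<^sub>1, - v\<^sub>m\<^sub>+\<^sub>1}\<close>, and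
  replacing a basis vector \<open>w\<close> by \<open>- w\<close> changes neither the span nor the term \<open>w \<partial>\<^sub>w\<close>
  of the Cauchy-Riemann operator (\<open>Reg_unit_steps\<close>).

  For the other direction linear functions suffice.  For \<open>e \<le> n\<close> consider the linear map \<open>L\<close> with
  \<open>L v\<^sub>i = - v\<^sub>i\<close> for \<open>1 \<le> i \<le> e\<close>, \<open>L v\<^sub>i = 0\<close> for \<open>i > e\<close>, and \<open>L 1 = - N\<close>.  On an
  adapted basis the Cauchy-Riemann operator maps \<open>L\<close> to the constant \<open>L 1 + \<Sum>\<^sub>J J L(J)\<close>, the sum ranging
  over the imaginary basis vectors.  As \<open>J\<^sup>2 = - 1\<close>, a block contained in \<open>{1..e}\<close> contributes \<open>1\<close>
  and a block beyond \<open>e\<close> contributes \<open>0\<close>.  So if \<open>e\<close> is the right end of a block of \<open>T\<close> and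
  \<open>N\<close> is the number of blocks inside \<open>{1..e}\<close>, then \<open>L\<close> is \<open>T\<close>-regular
  (\<open>cr_truncation_adapted\<close>).

  Suppose now that \<open>L\<close> is also \<open>T'\<close>-regular, and that \<open>e\<close> lies strictly inside a block of \<open>T'\<close>.
  For \<open>J = \<Sum> y\<^sub>i v\<^sub>i\<close> in the sphere of that block, the real part of \<open>J L(J)\<close>
  is \<open>\<Sum>\<^sub>i\<^sub>\<le>\<^sub>e y\<^sub>i\<^sup>2\<close> by the Clifford relations.  If no \<open>y\<^sub>i\<close> vanishes, this number is strictly
  between \<open>0\<close> and \<open>1\<close>, whereas all other contributions are integers, and the total cannot be \<open>0\<close>
  (\<open>block_end_if_truncation_regular\<close>).  Such a \<open>J\<close> exists because the open set \<open>\<Omega>\<close> contains a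
  point with no vanishing coordinate.  Hence every block end of \<open>T\<close> is one of \<open>T'\<close>, and the case
  \<open>e = n\<close> shows that \<open>T\<close> and \<open>T'\<close> have equally many blocks.
\<close>

section \<open>The blocks of a list of steps\<close>

text \<open>
  Besides the right ends of the blocks the set contains \<open>0\<close>: then two lists with the same block ends
  differ only by unit steps in front even if one of them starts with \<open>0\<close>.
\<close>

definition block_ends :: "nat list \<Rightarrow> nat set" where
  "block_ends T = {..T ! 0} \<union> set T"

text \<open>
  The number of blocks contained in \<open>{1..e}\<close>, in the shape in which it arises from the
  Cauchy-Riemann operator: first the singletons, then the blocks that carry a sphere.
\<close>

definition block_count :: "nat list \<Rightarrow> nat \<Rightarrow> nat" where
  "block_count T e = (\<Sum>i=1..T ! 0. if i \<le> e then 1 else 0) +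
     (\<Sum>h<length T - 1. if T ! (h + 1) \<le> e then 1 else 0)"

lemma list_of_steps_strict:
  assumes "list_of_steps n \<tau> T" "i < j" "j < length T"
  shows "T ! i < T ! j"
  using assms unfolding list_of_steps_def by (auto simp: sorted_wrt_nth_less)

lemma list_of_steps_le:
  assumes "list_of_steps n \<tau> T" "i < length T"
  shows "T ! i \<le> n"
proof (cases "i = \<tau>")
  case False
  then show ?thesis
    using assms list_of_steps_strict[OF assms(1), of i \<tau>] by (auto simp: list_of_steps_def)
qed (use assms in \<open>auto simp: list_of_steps_def\<close>)

lemma card_block_ends:
  assumes "list_of_steps n \<tau> T"
  shows "card (block_ends T) = T ! 0 + length T"
proof -
  have ne: "T \<noteq> []" and s: "sorted_wrt (<) T" using assms by (auto simp: list_of_steps_def)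
  have "T ! 0 \<le> x" if "x \<in> set T" for x
    using that list_of_steps_strict[OF assms, of 0] by (metis gr0I in_set_conv_nth le_eq_less_or_eq)
  then have "{..<T ! 0} \<inter> set T = {}" by fastforce
  moreover have "block_ends T = {..<T ! 0} \<union> set T"
    using ne by (auto simp: block_ends_def order.order_iff_strict)
  moreover have "card (set T) = length T"
    using s by (intro distinct_card) (simp add: strict_sorted_iff)
  ultimately show ?thesis by (simp add: card_Un_disjoint)
qed

lemma block_count_all:
  assumes "list_of_steps n \<tau> T"
  shows "block_count T n = T ! 0 + \<tau>"
proof -
  have l: "length T = \<tau> + 1" using assms by (simp add: list_of_steps_def)
  have "(\<Sum>i=1..T ! 0. if i \<le> n then 1 else 0::nat) = (\<Sum>i=1..T ! 0. 1)"
    using list_of_steps_le[OF assms, of 0] l by (intro sum.cong) auto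
  moreover have "(\<Sum>h<\<tau>. if T ! (h + 1) \<le> n then 1 else 0::nat) = (\<Sum>h<\<tau>. 1)"
    using list_of_steps_le[OF assms] l by (intro sum.cong) auto
  ultimately show ?thesis by (simp add: block_count_def l)
qed

lemma last_mem_block_ends:
  assumes "list_of_steps n \<tau> T"
  shows "n \<in> block_ends T"
  using assms nth_mem[of \<tau> T] by (simp add: block_ends_def list_of_steps_def)

text \<open>
  A list is recovered from its block ends and its first entry, as the block ends that are not below this
  entry.  So the list with the smaller first entry has to run through all integers up to the first
  entry of the other one before it continues like it.
\<close>

lemma block_ends_eq_imp_prefix:
  assumes T: "list_of_steps n \<tau> T" and T': "list_of_steps n \<tau>' T'"
    and eq: "block_ends T = block_ends T'" and le: "T' ! 0 \<le> T ! 0"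
  shows "T' = [T' ! 0..<T ! 0] @ T"
proof (rule strict_sorted_equal)
  have ne: "T \<noteq> []" "T' \<noteq> []" using T T' by (auto simp: list_of_steps_def)
  have min: "T ! 0 \<le> x" if "x \<in> set T" for x
    using that list_of_steps_strict[OF T, of 0] by (metis gr0I in_set_conv_nth le_eq_less_or_eq)
  have min': "T' ! 0 \<le> x" if "x \<in> set T'" for x
    using that list_of_steps_strict[OF T', of 0] by (metis gr0I in_set_conv_nth le_eq_less_or_eq)
  show "sorted_wrt (<) T'" using T' by (simp add: list_of_steps_def)
  show "sorted_wrt (<) ([T' ! 0..<T ! 0] @ T)"
    using T min by (fastforce simp: list_of_steps_def sorted_wrt_append intro: order.strict_trans2)
  have "set T' = block_ends T' \<inter> {T' ! 0..}"
    using min' ne by (auto simp: block_ends_def le_antisym dest: nth_mem)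
  also have "block_ends T' = {..<T ! 0} \<union> set T"
    unfolding eq[symmetric] using ne by (auto simp: block_ends_def order.order_iff_strict)
  also have "({..<T ! 0} \<union> set T) \<inter> {T' ! 0..} = set ([T' ! 0..<T ! 0] @ T)"
    using min le by fastforce
  finally show "set T' = set ([T' ! 0..<T ! 0] @ T)" .
qed

section \<open>Derivatives along the directions of an adapted basis\<close>

lemma open_line_preimage:
  fixes x w :: "'a::real_normed_vector"
  assumes V: "subspace V" and \<Omega>: "openin (top_of_set V) \<Omega>" and x: "x \<in> \<Omega>" and w: "w \<in> V"
  shows "open {s. x + s *\<^sub>R w \<in> \<Omega>}"
proof -
  obtain U where U: "open U" "\<Omega> = V \<inter> U" using \<Omega> by (auto simp: openin_open)
  have "x + s *\<^sub>R w \<in> V" for s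
    using x U V w by (auto intro: subspace_add subspace_scale)
  then have "{s. x + s *\<^sub>R w \<in> \<Omega>} = (\<lambda>s. x + s *\<^sub>R w) -` U" using U by auto
  moreover have "open ((\<lambda>s. x + s *\<^sub>R w) -` U)"
    using U(1) by (intro open_vimage continuous_intros)
  ultimately show ?thesis by simp
qed

lemma has_vector_derivative_restrict_linear:
  fixes L :: "'a::euclidean_space \<Rightarrow> 'b::real_normed_vector"
  assumes L: "linear L" and "subspace V" "openin (top_of_set V) \<Omega>" "x \<in> \<Omega>" "w \<in> V"
  shows "((\<lambda>s. restrict L \<Omega> (x + s *\<^sub>R w)) has_vector_derivative L w) (at 0)"
proof (rule has_vector_derivative_transform_within_open)
  show "open {s. x + s *\<^sub>R w \<in> \<Omega>}" using assms by (intro open_line_preimage)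
  show "0 \<in> {s. x + s *\<^sub>R w \<in> \<Omega>}" using assms by simp
  show "((\<lambda>s. L x + s *\<^sub>R L w) has_vector_derivative L w) (at 0)"
    by (auto intro!: derivative_eq_intros)
qed (simp add: linear_add[OF L] linear_scale[OF L])

lemma cr_operator_sum_list:
  "cr_operator ws f x = (\<Sum>w\<leftarrow>ws. w * partial_deriv f w x)"
  by (simp add: cr_operator_def sum_list_sum_nth atLeast0LessThan)

lemma has_vector_derivative_reverse_direction:
  assumes "(\<lambda>s::real. f (x + s *\<^sub>R w)) differentiable at 0"
  shows "((\<lambda>s. f (x + s *\<^sub>R - w)) has_vector_derivative - partial_deriv f w x) (at 0)"
proof -
  have "((\<lambda>s. f (x + s *\<^sub>R w)) has_vector_derivative partial_deriv f w x) (at (- 0))"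
    using assms by (simp add: partial_deriv_def vector_derivative_works)
  then have "((\<lambda>s. f (x + s *\<^sub>R w)) \<circ> uminus has_vector_derivative (- 1) *\<^sub>R partial_deriv f w x) (at 0)"
    by (intro vector_diff_chain_at) (auto intro!: derivative_eq_intros)
  then show ?thesis by (simp add: o_def)
qed

text \<open>
  Differentiability has to be part of the hypothesis: where the derivative along \<open>w\<close> does not exist,
  \<open>partial_deriv\<close> is an arbitrary value, for which the sign rule may fail.
\<close>

lemma C1_on_negate:
  assumes "C1_on (as @ w # bs) U f"
  shows "C1_on (as @ - w # bs) U f"
    and "\<And>x. x \<in> U \<Longrightarrow> partial_deriv f (- w) x = - partial_deriv f w x"
proof -
  have w: "\<And>x. x \<in> U \<Longrightarrow> (\<lambda>s. f (x + s *\<^sub>R w)) differentiable at 0"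
    "continuous_on U (partial_deriv f w)"
    using assms by (auto simp: C1_on_def)
  show pd: "partial_deriv f (- w) x = - partial_deriv f w x" if "x \<in> U" for x
    using has_vector_derivative_reverse_direction[OF w(1)[OF that]]
    unfolding partial_deriv_def by (rule vector_derivative_at)
  have "(\<lambda>s. f (x + s *\<^sub>R - w)) differentiable at 0" if "x \<in> U" for x
    using has_vector_derivative_reverse_direction[OF w(1)[OF that]] by (rule differentiableI_vector)
  moreover have "continuous_on U (partial_deriv f (- w))"
    using continuous_on_minus[OF w(2)] pd by (simp cong: continuous_on_cong)
  ultimately show "C1_on (as @ - w # bs) U f"
    using assms by (simp add: C1_on_def)
qed

lemma span_negate: "span (set (as @ - w # bs)) = span (set (as @ w # bs))"
proof -
  have sub: "span (set (as @ - w # bs)) \<subseteq> span (set (as @ w # bs))" for w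
    by (rule span_minimal) (auto intro: span_base span_neg)
  from sub[of w] sub[of "- w"] show ?thesis by auto
qed

text \<open>
  In \<open>w \<partial>\<^sub>w\<close> the signs of the factor and of the derivative cancel.
\<close>

lemma regular_on_negate:
  fixes \<Omega> :: "'a::{real_algebra_1, euclidean_space} set"
  defines "regular ws f \<equiv> C1_on ws (\<Omega> \<inter> span (set ws)) f \<and>
    (\<forall>x\<in>\<Omega> \<inter> span (set ws). cr_operator ws f x = 0)"
  shows "regular (as @ - w # bs) f \<longleftrightarrow> regular (as @ w # bs) f"
proof -
  have "regular (as @ - w # bs) f" if "regular (as @ w # bs) f" for w
  proof -
    have C1: "C1_on (as @ w # bs) (\<Omega> \<inter> span (set (as @ w # bs))) f"
      using that by (simp add: regular_def)
    show ?thesis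
      using that C1_on_negate[OF C1]
      unfolding regular_def span_negate cr_operator_sum_list by (simp add: ac_simps)
  qed
  from this[of w] this[of "- w"] show ?thesis by auto
qed

section \<open>Clifford relations and spheres\<close>

locale imaginary_frame =
  fixes c :: "'a::{real_algebra_1, euclidean_space} \<Rightarrow> 'a"
    and v :: "nat \<Rightarrow> 'a" and n :: nat and B :: "'a set"
  assumes star: "star_involution c"
    and basis: "hypercomplex_basis c (span (v ` {0..n})) n v"
    and completion: "completes_basis n v B"
begin

lemma v_0 [simp]: "v 0 = 1"
  using basis by (simp add: hypercomplex_basis_def)

lemma v_inj: "inj_on v {0..n}"
  using basis by (simp add: hypercomplex_basis_def)

lemma star_v:
  assumes "i \<in> {1..n}" shows "c (v i) = - v i"
proof -
  have "v i + c (v i) = 0"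
    using basis assms by (auto simp: hypercomplex_basis_def imag_units_def star_trace_def)
  then show ?thesis by (simp add: eq_neg_iff_add_eq_0 add.commute)
qed

lemma v_square:
  assumes "i \<in> {1..n}" shows "v i * v i = - 1"
proof -
  have "v i * c (v i) = 1"
    using basis assms by (auto simp: hypercomplex_basis_def imag_units_def star_norm_def)
  then show ?thesis using star_v[OF assms] by (simp add: minus_equation_iff)
qed

lemma v_anticommute:
  assumes "i \<in> {1..n}" "k \<in> {1..n}" "i \<noteq> k"
  shows "v i * v k = - (v k * v i)"
  using basis assms unfolding hypercomplex_basis_def by blast

text \<open>
  The imaginary basis vectors square to \<open>- 1\<close> and anticommute, so symmetrised products of their
  combinations are real: they are a multiple of the Euclidean inner product.
\<close>

lemma clifford_relation:
  assumes "I \<subseteq> {1..n}"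
  shows "(\<Sum>i\<in>I. p i *\<^sub>R v i) * (\<Sum>i\<in>I. q i *\<^sub>R v i) + (\<Sum>i\<in>I. q i *\<^sub>R v i) * (\<Sum>i\<in>I. p i *\<^sub>R v i)
    = of_real (- 2 * (\<Sum>i\<in>I. p i * q i))"
proof -
  have fin: "finite I" using assms finite_subset by blast
  have pair: "v i * v k + v k * v i = (if i = k then - 2 else 0)" if "i \<in> I" "k \<in> I" for i k
    using that assms v_anticommute[of i k] v_square[of i] by (auto simp: subset_iff)
  have "(\<Sum>i\<in>I. p i *\<^sub>R v i) * (\<Sum>i\<in>I. q i *\<^sub>R v i) + (\<Sum>i\<in>I. q i *\<^sub>R v i) * (\<Sum>i\<in>I. p i *\<^sub>R v i)
    = (\<Sum>i\<in>I. \<Sum>k\<in>I. (p i * q k) *\<^sub>R (v i * v k)) + (\<Sum>k\<in>I. \<Sum>i\<in>I. (p i * q k) *\<^sub>R (v k * v i))"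
    by (simp add: sum_product mult.commute)
  also have "(\<Sum>k\<in>I. \<Sum>i\<in>I. (p i * q k) *\<^sub>R (v k * v i)) = (\<Sum>i\<in>I. \<Sum>k\<in>I. (p i * q k) *\<^sub>R (v k * v i))"
    by (rule sum.swap)
  also have "(\<Sum>i\<in>I. \<Sum>k\<in>I. (p i * q k) *\<^sub>R (v i * v k)) + (\<Sum>i\<in>I. \<Sum>k\<in>I. (p i * q k) *\<^sub>R (v k * v i))
    = (\<Sum>i\<in>I. \<Sum>k\<in>I. (p i * q k) *\<^sub>R (v i * v k + v k * v i))"
    by (simp add: sum.distrib scaleR_add_right)
  also have "\<dots> = (\<Sum>i\<in>I. \<Sum>k\<in>I. if i = k then (p i * q i) *\<^sub>R (- 2) else 0)"
    by (intro sum.cong) (auto simp: pair)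
  also have "\<dots> = (\<Sum>i\<in>I. (p i * q i) *\<^sub>R (- 2))"
    using fin by simp
  also have "\<dots> = (\<Sum>i\<in>I. of_real (p i * q i * - 2))"
    by (simp add: scaleR_conv_of_real)
  also have "\<dots> = of_real (\<Sum>i\<in>I. p i * q i * - 2)"
    by (simp only: of_real_sum)
  also have "(\<Sum>i\<in>I. p i * q i * - 2) = - 2 * (\<Sum>i\<in>I. p i * q i)"
    unfolding sum_distrib_left by (intro sum.cong) auto
  finally show ?thesis .
qed

lemma basis_norm_sum:
  assumes "I \<subseteq> {0..n}"
  shows "basis_norm B (\<Sum>i\<in>I. y i *\<^sub>R v i) = sqrt (\<Sum>i\<in>I. (y i)\<^sup>2)"
proof -
  have indB: "independent B" and sp: "span B = UNIV" and sub: "v ` {0..n} \<subseteq> B"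
    using completion by (auto simp: completes_basis_def)
  have finB: "finite B" using indB by (rule independent_imp_finite)
  have finI: "finite I" using assms finite_subset by blast
  have inj: "inj_on v I" using v_inj assms by (rule inj_on_subset)
  have vB: "v i \<in> B" if "i \<in> I" for i using that assms sub by auto
  have rep: "representation B (\<Sum>i\<in>I. y i *\<^sub>R v i) b = (\<Sum>i\<in>I. y i * (if b = v i then 1 else 0))" for b
    using indB sp vB
    by (simp add: representation_sum representation_scale representation_basis)
  have "(\<Sum>b\<in>B. (representation B (\<Sum>i\<in>I. y i *\<^sub>R v i) b)\<^sup>2)
    = (\<Sum>b\<in>v ` I. (representation B (\<Sum>i\<in>I. y i *\<^sub>R v i) b)\<^sup>2)"
    by (rule sum.mono_neutral_right) (use finB vB in \<open>auto simp: rep intro!: sum.neutral\<close>)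
  also have "\<dots> = (\<Sum>k\<in>I. (representation B (\<Sum>i\<in>I. y i *\<^sub>R v i) (v k))\<^sup>2)"
    by (simp add: sum.reindex[OF inj])
  also have "\<dots> = (\<Sum>k\<in>I. (y k)\<^sup>2)"
  proof (rule sum.cong[OF refl])
    fix k assume k: "k \<in> I"
    have "(\<Sum>i\<in>I. y i * (if v k = v i then 1 else 0)) = (\<Sum>i\<in>I. if k = i then y i else 0)"
      using inj k by (intro sum.cong) (auto dest: inj_onD)
    then show "(representation B (\<Sum>i\<in>I. y i *\<^sub>R v i) (v k))\<^sup>2 = (y k)\<^sup>2"
      using k finI by (simp add: rep)
  qed
  finally show ?thesis by (simp add: basis_norm_def)
qed

lemma span_frameE:
  assumes "x \<in> span (v ` I)" "I \<subseteq> {0..n}"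
  obtains y where "x = (\<Sum>i\<in>I. y i *\<^sub>R v i)"
proof -
  have "finite I" and inj: "inj_on v I"
    using assms(2) v_inj by (auto intro: finite_subset inj_on_subset)
  then obtain u where "x = (\<Sum>b\<in>v ` I. u b *\<^sub>R b)"
    using assms(1) by (auto simp: span_finite)
  then show thesis using that[of "u \<circ> v"] by (simp add: sum.reindex[OF inj])
qed

lemma mem_coord_sphere_iff:
  assumes "m \<le> n"
  shows "x \<in> coord_sphere v B l m \<longleftrightarrow>
    (\<exists>y. x = (\<Sum>i=l..m. y i *\<^sub>R v i) \<and> (\<Sum>i=l..m. (y i)\<^sup>2) = 1)"
proof
  have sub: "{l..m} \<subseteq> {0..n}" using assms by auto
  show "\<exists>y. x = (\<Sum>i=l..m. y i *\<^sub>R v i) \<and> (\<Sum>i=l..m. (y i)\<^sup>2) = 1"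
    if "x \<in> coord_sphere v B l m"
  proof -
    from that obtain y where x: "x = (\<Sum>i=l..m. y i *\<^sub>R v i)"
      using span_frameE[OF _ sub] by (auto simp: coord_sphere_def)
    then show ?thesis using that basis_norm_sum[OF sub, of y] by (auto simp: coord_sphere_def)
  qed
  show "x \<in> coord_sphere v B l m"
    if "\<exists>y. x = (\<Sum>i=l..m. y i *\<^sub>R v i) \<and> (\<Sum>i=l..m. (y i)\<^sup>2) = 1"
    using that basis_norm_sum[OF sub]
    by (auto simp: coord_sphere_def intro!: span_sum span_scale intro: span_base)
qed

lemma coord_sphere_square:
  assumes "J \<in> coord_sphere v B l m" "1 \<le> l" "m \<le> n"
  shows "J * J = - 1"
proof -
  obtain y where J: "J = (\<Sum>i=l..m. y i *\<^sub>R v i)" and y: "(\<Sum>i=l..m. (y i)\<^sup>2) = 1"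
    using assms mem_coord_sphere_iff by blast
  have "J * J + J * J = of_real (- 2 * (\<Sum>i=l..m. y i * y i))"
    unfolding J by (rule clifford_relation) (use assms in auto)
  also have "(\<Sum>i=l..m. y i * y i) = 1"
    using y by (simp add: power2_eq_square)
  finally have "2 *\<^sub>R (J * J) = 2 *\<^sub>R (- 1)"
    by (simp add: scaleR_2)
  then show ?thesis by (simp only: scaleR_cancel_left) simp
qed

lemma coord_sphere_singleton:
  assumes "k \<le> n" shows "coord_sphere v B k k = {v k, - v k}"
proof (intro set_eqI iffI)
  fix x assume "x \<in> coord_sphere v B k k"
  then obtain y :: "nat \<Rightarrow> real" where "x = y k *\<^sub>R v k" "(y k)\<^sup>2 = 1"
    using mem_coord_sphere_iff[OF assms, of x k] by auto
  then show "x \<in> {v k, - v k}" by (auto simp: power2_eq_1_iff)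
next
  fix x assume "x \<in> {v k, - v k}"
  then obtain a :: real where "x = a *\<^sub>R v k" "a\<^sup>2 = 1"
    by (metis insertE power2_minus power_one scaleR_minus1_left scaleR_one singletonD)
  then show "x \<in> coord_sphere v B k k"
    using mem_coord_sphere_iff[OF assms, of x k] by (auto intro!: exI[of _ "\<lambda>_. a"])
qed

section \<open>Regularity of linear functions\<close>

lemma span_block_subset: "m \<le> n \<Longrightarrow> span (v ` {l..m}) \<subseteq> span (v ` {0..n})"
  by (intro span_mono image_mono) auto

lemma torus_nth:
  assumes "list_of_steps n \<tau> T" "J \<in> torus v B T" "h < \<tau>"
  shows "J ! h \<in> coord_sphere v B (T ! h + 1) (T ! (h + 1))"
  using assms by (auto simp: torus_def list_of_steps_def)

lemma torus_length:
  assumes "list_of_steps n \<tau> T" "J \<in> torus v B T"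
  shows "length J = \<tau>"
  using assms by (auto simp: torus_def list_of_steps_def)

lemma adapted_basis_subset:
  assumes T: "list_of_steps n \<tau> T" and J: "J \<in> torus v B T"
  shows "set (adapted_basis v T J) \<subseteq> span (v ` {0..n})"
proof -
  have l: "length T = \<tau> + 1" using T by (simp add: list_of_steps_def)
  have "J ! h \<in> span (v ` {0..n})" if "h < \<tau>" for h
  proof -
    have "T ! (h + 1) \<le> n" using list_of_steps_le[OF T] l that by simp
    then show ?thesis
      using torus_nth[OF T J that] span_block_subset by (auto simp: coord_sphere_def)
  qed
  moreover have "v i \<in> span (v ` {0..n})" if "i \<le> T ! 0" for i
    using that list_of_steps_le[OF T, of 0] l by (intro span_base) auto
  ultimately show ?thesis
    using torus_length[OF T J] by (auto simp: adapted_basis_def in_set_conv_nth)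
qed

lemma sum_list_adapted_basis:
  assumes "length J = \<tau>"
  shows "(\<Sum>w\<leftarrow>adapted_basis v T J. w * L w)
    = L 1 + (\<Sum>i=1..T ! 0. v i * L (v i)) + (\<Sum>h<\<tau>. J ! h * L (J ! h))"
proof -
  have "{0..<T ! 0 + 1} = insert 0 {1..T ! 0}" by auto
  then have "(\<Sum>w\<leftarrow>map v [0..<T ! 0 + 1]. w * L w) = L 1 + (\<Sum>i=1..T ! 0. v i * L (v i))"
    by (simp add: o_def interv_sum_list_conv_sum_set_nat del: upt_Suc)
  moreover have "(\<Sum>w\<leftarrow>J. w * L w) = (\<Sum>h<\<tau>. J ! h * L (J ! h))"
    using assms by (simp add: sum_list_sum_nth atLeast0LessThan)
  ultimately show ?thesis by (simp add: adapted_basis_def del: upt_Suc)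
qed

text \<open>
  The partial derivatives of a linear map are constant, so on each slice that is met by \<open>\<Omega>\<close>
  regularity is a single equation in the algebra.
\<close>

lemma restrict_linear_Reg_iff:
  assumes T: "list_of_steps n \<tau> T" and L: "linear L"
    and \<Omega>: "openin (top_of_set (span (v ` {0..n}))) \<Omega>"
  shows "restrict L \<Omega> \<in> Reg v B T \<Omega> \<longleftrightarrow>
    (\<forall>J\<in>torus v B T. slice v T J \<Omega> \<noteq> {} \<longrightarrow> (\<Sum>w\<leftarrow>adapted_basis v T J. w * L w) = 0)"
proof -
  have D: "((\<lambda>s. restrict L \<Omega> (x + s *\<^sub>R w)) has_vector_derivative L w) (at 0)"
    if "J \<in> torus v B T" "w \<in> set (adapted_basis v T J)" "x \<in> slice v T J \<Omega>" for J w x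
  proof (rule has_vector_derivative_restrict_linear[OF L subspace_span \<Omega>])
    show "x \<in> \<Omega>" using that by (simp add: slice_def)
    show "w \<in> span (v ` {0..n})" using that adapted_basis_subset[OF T] by blast
  qed
  have pd: "partial_deriv (restrict L \<Omega>) w x = L w"
    if "J \<in> torus v B T" "w \<in> set (adapted_basis v T J)" "x \<in> slice v T J \<Omega>" for J w x
    using D[OF that] by (simp add: partial_deriv_def vector_derivative_at)
  have C1: "C1_on (adapted_basis v T J) (slice v T J \<Omega>) (restrict L \<Omega>)"
    if J: "J \<in> torus v B T" for J
    unfolding C1_on_def
  proof (intro ballI conjI)
    fix w assume w: "w \<in> set (adapted_basis v T J)"
    show "(\<lambda>s. restrict L \<Omega> (x + s *\<^sub>R w)) differentiable at 0" if "x \<in> slice v T J \<Omega>" for x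
      using D[OF J w that] by (rule differentiableI_vector)
    show "continuous_on (slice v T J \<Omega>) (partial_deriv (restrict L \<Omega>) w)"
      using pd[OF J w] by (simp cong: continuous_on_cong_simp)
  qed
  have cr: "cr_operator (adapted_basis v T J) (restrict L \<Omega>) x = (\<Sum>w\<leftarrow>adapted_basis v T J. w * L w)"
    if "J \<in> torus v B T" "x \<in> slice v T J \<Omega>" for J x
    unfolding cr_operator_sum_list
    using pd[OF that(1) _ that(2)] by (intro arg_cong[where f = sum_list] map_cong) auto
  show ?thesis
    unfolding Reg_def using C1 cr by auto
qed

section \<open>The test functions\<close>

text \<open>
  Apart from the sign and the value at \<open>1\<close>, the test function is the coordinate projection onto the span of
  \<open>v\<^sub>1, \<dots>, v\<^sub>e\<close>.  It does not respect the rotations of a block that \<open>e\<close> cuts in two, which is what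
  makes it detect block ends.
\<close>

lemma truncation_exists:
  obtains L :: "'a \<Rightarrow> 'a" where "linear L" "L 1 = of_real a"
    "\<And>i. i \<in> {1..n} \<Longrightarrow> L (v i) = (if i \<le> e then - v i else 0)"
proof -
  define g where "g i = (if i = 0 then of_real a else if i \<le> e then - v i else 0)" for i
  have "independent (v ` {0..n})" using basis by (simp add: hypercomplex_basis_def)
  then obtain L where L: "linear L" "\<forall>x\<in>v ` {0..n}. L x = g (the_inv_into {0..n} v x)"
    using linear_independent_extend[of "v ` {0..n}" "\<lambda>x. g (the_inv_into {0..n} v x)"] by blast
  then have "L (v i) = g i" if "i \<le> n" for i
    using that v_inj by (simp add: the_inv_into_f_f)
  from this[of 0] this show thesis
    by (intro that[OF L(1)]) (auto simp: g_def)
qed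

lemma truncation_block:
  assumes L: "linear L" "\<And>i. i \<in> {1..n} \<Longrightarrow> L (v i) = (if i \<le> e then - v i else 0)"
    and lm: "1 \<le> l" "m \<le> n"
  shows "L (\<Sum>i=l..m. y i *\<^sub>R v i) = (\<Sum>i=l..m. (if i \<le> e then - y i else 0) *\<^sub>R v i)"
proof -
  have "L (\<Sum>i=l..m. y i *\<^sub>R v i) = (\<Sum>i=l..m. y i *\<^sub>R L (v i))"
    by (simp add: linear_sum[OF L(1)] linear_scale[OF L(1)])
  also have "\<dots> = (\<Sum>i=l..m. (if i \<le> e then - y i else 0) *\<^sub>R v i)"
    using lm by (intro sum.cong) (auto simp: L(2))
  finally show ?thesis .
qed

text \<open>
  The trace isolates the real part: both \<open>J\<close> and \<open>L J\<close> are combinations of the skew elements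
  \<open>v\<^sub>i\<close>, so conjugation reverses their product without changing its sign, and the Clifford relation
  applies to \<open>J L(J) + L(J) J\<close>.
\<close>

lemma star_trace_truncation_block:
  assumes L: "linear L" "\<And>i. i \<in> {1..n} \<Longrightarrow> L (v i) = (if i \<le> e then - v i else 0)"
    and lm: "1 \<le> l" "m \<le> n" and J: "J = (\<Sum>i=l..m. y i *\<^sub>R v i)"
  shows "star_trace c (J * L J) = of_real (2 * (\<Sum>i=l..m. if i \<le> e then (y i)\<^sup>2 else 0))"
proof -
  have cv: "c (\<Sum>i=l..m. z i *\<^sub>R v i) = - (\<Sum>i=l..m. z i *\<^sub>R v i)" for z
  proof -
    have lin: "linear c" using star by (simp add: star_involution_def)
    have "c (\<Sum>i=l..m. z i *\<^sub>R v i) = (\<Sum>i=l..m. z i *\<^sub>R c (v i))"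
      by (simp add: linear_sum[OF lin] linear_scale[OF lin])
    also have "\<dots> = (\<Sum>i=l..m. - (z i *\<^sub>R v i))"
      using lm by (intro sum.cong) (auto simp: star_v)
    finally show ?thesis by (simp add: sum_negf)
  qed
  define z where "z i = (if i \<le> e then - y i else 0)" for i
  have LJ: "L J = (\<Sum>i=l..m. z i *\<^sub>R v i)"
    unfolding J z_def by (rule truncation_block[OF L lm])
  have "c (J * L J) = c (L J) * c J" using star by (simp add: star_involution_def)
  also have "\<dots> = L J * J" unfolding LJ unfolding J cv by simp
  finally have "star_trace c (J * L J) = J * L J + L J * J" by (simp add: star_trace_def)
  also have "\<dots> = of_real (- 2 * (\<Sum>i=l..m. y i * z i))"
    unfolding LJ unfolding J by (rule clifford_relation) (use lm in auto)
  also have "- 2 * (\<Sum>i=l..m. y i * z i) = 2 * (\<Sum>i=l..m. if i \<le> e then (y i)\<^sup>2 else 0)"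
    unfolding mult_minus_left sum_distrib_left sum_negf[symmetric]
    by (intro sum.cong) (auto simp: z_def power2_eq_square)
  finally show ?thesis .
qed

text \<open>
  On the sphere of a block that \<open>e\<close> does not cut, \<open>L\<close> is either \<open>J \<mapsto> - J\<close> or zero.
\<close>

lemma truncation_on_sphere:
  assumes L: "linear L" "\<And>i. i \<in> {1..n} \<Longrightarrow> L (v i) = (if i \<le> e then - v i else 0)"
    and J: "J \<in> coord_sphere v B l m" and lm: "1 \<le> l" "m \<le> n" and e: "m \<le> e \<or> e < l"
  shows "J * L J = of_nat (if m \<le> e then 1 else 0)"
proof -
  obtain y where y: "J = (\<Sum>i=l..m. y i *\<^sub>R v i)" "(\<Sum>i=l..m. (y i)\<^sup>2) = 1"
    using J lm mem_coord_sphere_iff by blast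
  then have "l \<le> m" by (cases "l \<le> m") auto
  have LJ: "L J = (\<Sum>i=l..m. (if i \<le> e then - y i else 0) *\<^sub>R v i)"
    unfolding y by (rule truncation_block[OF L lm])
  show ?thesis
  proof (cases "m \<le> e")
    case True
    have "L J = - J" unfolding LJ unfolding y(1) sum_negf[symmetric]
      by (rule sum.cong) (use True in auto)
    then show ?thesis using True coord_sphere_square[OF J lm] by simp
  next
    case False
    have "L J = 0" unfolding LJ by (rule sum.neutral) (use False e in auto)
    then show ?thesis using False by simp
  qed
qed

text \<open>
  A block end cuts no block, so every imaginary vector of an adapted basis contributes \<open>1\<close> or \<open>0\<close>
  according to whether its block lies below \<open>e\<close>.  The value does not depend on \<open>J\<close>: with
  \<open>L 1 = - block_count T e\<close> all slices are served at once.
\<close>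

lemma cr_truncation_adapted:
  assumes T: "list_of_steps n \<tau> T" and e: "e \<in> block_ends T" and J: "J \<in> torus v B T"
    and L: "linear L" "\<And>i. i \<in> {1..n} \<Longrightarrow> L (v i) = (if i \<le> e then - v i else 0)"
  shows "(\<Sum>w\<leftarrow>adapted_basis v T J. w * L w) = L 1 + of_nat (block_count T e)"
proof -
  have l: "length T = \<tau> + 1" using T by (simp add: list_of_steps_def)
  have "v i * L (v i) = of_nat (if i \<le> e then 1 else 0)" if "i \<in> {1..T ! 0}" for i
    using that list_of_steps_le[OF T, of 0] l by (auto simp: L(2) v_square)
  moreover have "J ! h * L (J ! h) = of_nat (if T ! (h + 1) \<le> e then 1 else 0)" if h: "h < \<tau>" for h
  proof (rule truncation_on_sphere[OF L torus_nth[OF T J h]])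
    show "T ! (h + 1) \<le> n" using list_of_steps_le[OF T] l h by simp
    have mono: "T ! i \<le> T ! j" if "i \<le> j" "j \<le> \<tau>" for i j
      using list_of_steps_strict[OF T, of i j] that l by (cases "i = j") auto
    from e consider "e \<le> T ! 0" | j where "j \<le> \<tau>" "e = T ! j"
      using l by (auto simp: block_ends_def in_set_conv_nth less_Suc_eq_le)
    then show "T ! (h + 1) \<le> e \<or> e < T ! h + 1"
    proof cases
      case 1
      then show ?thesis using mono[of 0 h] h by simp
    next
      case 2
      then show ?thesis using mono[of "h + 1" j] mono[of j h] h by (cases "h + 1 \<le> j") auto
    qed
  qed auto
  ultimately show ?thesis
    using torus_length[OF T J] l
    by (simp add: sum_list_adapted_basis block_count_def)
qed

section \<open>Cutting a block destroys regularity\<close>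

text \<open>
  Moving a point of \<open>\<Omega>\<close> along \<open>v\<^sub>0 + \<dots> + v\<^sub>n\<close> shifts all coordinates by the same small amount, and
  only finitely many shifts make one of them vanish.  Coordinates beyond \<open>n\<close> are
  given the value \<open>1\<close>, so that the second conclusion needs no bound.
\<close>

lemma generic_point:
  assumes \<Omega>: "openin (top_of_set (span (v ` {0..n}))) \<Omega>" and ne: "\<Omega> \<noteq> {}"
  obtains p where "(\<Sum>i=0..n. p i *\<^sub>R v i) \<in> \<Omega>" "\<And>i. p i \<noteq> 0"
proof -
  obtain x where x: "x \<in> \<Omega>" using ne by blast
  moreover have "x \<in> span (v ` {0..n})" using openin_imp_subset[OF \<Omega>] x by blast
  ultimately obtain q where q: "x = (\<Sum>i=0..n. q i *\<^sub>R v i)" using span_frameE by blast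
  define w where "w = (\<Sum>i=0..n. v i)"
  have "w \<in> span (v ` {0..n})" unfolding w_def by (intro span_sum span_base) auto
  then have "open {s. x + s *\<^sub>R w \<in> \<Omega>}"
    using open_line_preimage[OF subspace_span \<Omega> x] by simp
  moreover have "0 \<in> {s. x + s *\<^sub>R w \<in> \<Omega>}" using x by simp
  ultimately obtain \<epsilon> where \<epsilon>: "\<epsilon> > 0" "cball 0 \<epsilon> \<subseteq> {s::real. x + s *\<^sub>R w \<in> \<Omega>}"
    using open_contains_cball by blast
  have "infinite {0..\<epsilon>}" using \<epsilon> by simp
  then have "\<not> {0..\<epsilon>} \<subseteq> (\<lambda>i. - q i) ` {0..n}" using finite_subset by blast
  then obtain s where s: "s \<in> {0..\<epsilon>}" "s \<notin> (\<lambda>i. - q i) ` {0..n}" by blast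
  define p where "p i = (if i \<le> n then q i + s else 1)" for i
  have "x + s *\<^sub>R w = (\<Sum>i=0..n. p i *\<^sub>R v i)"
    unfolding q w_def by (simp add: p_def scaleR_sum_right sum.distrib scaleR_add_left)
  moreover have "x + s *\<^sub>R w \<in> \<Omega>" using \<epsilon> s by (auto simp: subset_iff dist_norm)
  moreover have "p i \<noteq> 0" for i
    using s(2) by (auto simp: p_def image_iff eq_neg_iff_add_eq_0 add.commute)
  ultimately show thesis using that by metis
qed

text \<open>
  Normalising the component of a point in each block produces a point of the torus whose slice contains the
  given point, and normalising keeps the coordinates nonzero.
\<close>

lemma generic_torus_point:
  assumes T: "list_of_steps n \<tau> T" and p: "\<And>i. p i \<noteq> 0"
  obtains J y where "J \<in> torus v B T" "(\<Sum>i=0..n. p i *\<^sub>R v i) \<in> span (set (adapted_basis v T J))"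
    "\<forall>h<\<tau>. J ! h = (\<Sum>i=T ! h + 1..T ! (h + 1). y h i *\<^sub>R v i) \<and>
      (\<Sum>i=T ! h + 1..T ! (h + 1). (y h i)\<^sup>2) = 1 \<and> (\<forall>i. y h i \<noteq> 0)"
proof -
  have l: "length T = \<tau> + 1" and last: "T ! \<tau> = n" using T by (auto simp: list_of_steps_def)
  define r where "r h = sqrt (\<Sum>i=T ! h + 1..T ! (h + 1). (p i)\<^sup>2)" for h
  have r: "r h > 0" if "h < \<tau>" for h
  proof -
    have "T ! h < T ! (h + 1)" using list_of_steps_strict[OF T, of h "h + 1"] that l by simp
    then show ?thesis using p by (auto simp: r_def intro!: sum_pos)
  qed
  define y where "y h i = p i / r h" for h i
  define J where "J = map (\<lambda>h. \<Sum>i=T ! h + 1..T ! (h + 1). y h i *\<^sub>R v i) [0..<\<tau>]"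
  have Jh: "J ! h = (\<Sum>i=T ! h + 1..T ! (h + 1). y h i *\<^sub>R v i)" if "h < \<tau>" for h
    using that by (simp add: J_def)
  have unit: "(\<Sum>i=T ! h + 1..T ! (h + 1). (y h i)\<^sup>2) = 1" if "h < \<tau>" for h
  proof -
    have "(\<Sum>i=T ! h + 1..T ! (h + 1). (y h i)\<^sup>2) = (\<Sum>i=T ! h + 1..T ! (h + 1). (p i)\<^sup>2) / (r h)\<^sup>2"
      by (simp add: y_def power_divide sum_divide_distrib)
    also have "\<dots> = (r h)\<^sup>2 / (r h)\<^sup>2"
      by (simp add: r_def sum_nonneg)
    finally show ?thesis using r[OF that] by simp
  qed
  have "J \<in> torus v B T"
    unfolding torus_def
  proof (intro CollectI conjI allI impI)
    show "length J = length T - 1" by (simp add: J_def l)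
    fix h assume "h < length J"
    then have h: "h < \<tau>" by (simp add: J_def)
    have "T ! (h + 1) \<le> n" using list_of_steps_le[OF T] l h by simp
    then show "J ! h \<in> coord_sphere v B (T ! h + 1) (T ! (h + 1))"
      using Jh[OF h] unit[OF h] mem_coord_sphere_iff by blast
  qed
  moreover have "(\<Sum>i=0..n. p i *\<^sub>R v i) \<in> span (set (adapted_basis v T J))"
  proof -
    let ?S = "span (set (adapted_basis v T J))"
    \<comment> \<open>The blocks are added one at a time; after the last one the sum is complete, as \<open>T ! \<tau> = n\<close>.\<close>
    have "(\<Sum>i=0..T ! h. p i *\<^sub>R v i) \<in> ?S" if "h \<le> \<tau>" for h
      using that
    proof (induction h)
      case 0
      show ?case
        by (intro span_sum span_scale span_base) (auto simp: adapted_basis_def simp del: upt_Suc)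
    next
      case (Suc h)
      then have h: "h < \<tau>" by simp
      have "T ! h < T ! Suc h" using list_of_steps_strict[OF T, of h "Suc h"] h l by simp
      then have "{0..T ! Suc h} = {0..T ! h} \<union> {T ! h + 1..T ! (h + 1)}" by auto
      then have "(\<Sum>i=0..T ! Suc h. p i *\<^sub>R v i)
        = (\<Sum>i=0..T ! h. p i *\<^sub>R v i) + (\<Sum>i=T ! h + 1..T ! (h + 1). p i *\<^sub>R v i)"
        by (simp only:) (rule sum.union_disjoint; auto)
      also have "(\<Sum>i=T ! h + 1..T ! (h + 1). p i *\<^sub>R v i) = r h *\<^sub>R J ! h"
        using r[OF h] by (simp add: Jh[OF h] y_def scaleR_sum_right)
      finally have "(\<Sum>i=0..T ! Suc h. p i *\<^sub>R v i) = (\<Sum>i=0..T ! h. p i *\<^sub>R v i) + r h *\<^sub>R J ! h" .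
      moreover have "J ! h \<in> ?S"
        using h by (intro span_base) (auto simp: adapted_basis_def J_def)
      ultimately show ?case
        using Suc.IH h by (simp only: span_add span_scale less_imp_le)
    qed
    from this[of \<tau>] show ?thesis by (simp add: last)
  qed
  moreover have "y h i \<noteq> 0" if "h < \<tau>" for h i using p r[OF that] by (simp add: y_def)
  ultimately show thesis using that Jh unit by blast
qed

text \<open>
  A number up to \<open>n\<close> that is not a block end lies strictly inside exactly one block, and that block carries a sphere;
  the remaining alternative for the other blocks has the form required by \<open>truncation_on_sphere\<close>.
\<close>

lemma block_between:
  assumes T: "list_of_steps n \<tau> T" and e: "e \<le> n" "e \<notin> block_ends T"
  obtains h where "h < \<tau>" "T ! h < e" "e < T ! (h + 1)"
    "\<And>k. k < \<tau> \<Longrightarrow> k \<noteq> h \<Longrightarrow> T ! (k + 1) \<le> e \<or> e < T ! k + 1"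
proof -
  have l: "length T = \<tau> + 1" and last: "T ! \<tau> = n" using T by (auto simp: list_of_steps_def)
  have mono: "T ! i \<le> T ! j" if "i \<le> j" "j \<le> \<tau>" for i j
    using list_of_steps_strict[OF T, of i j] that l by (cases "i = j") auto
  define j where "j = (LEAST j. e \<le> T ! j)"
  have j: "e \<le> T ! j" "j \<le> \<tau>" using e(1) last
    unfolding j_def by (auto intro: LeastI[of _ \<tau>] Least_le)
  have "j \<noteq> 0" using e(2) j by (intro notI) (simp add: block_ends_def)
  then obtain h where h: "j = h + 1" by (metis Suc_eq_plus1 not0_implies_Suc)
  have "T ! h < e" using not_less_Least[of h "\<lambda>j. e \<le> T ! j"] h by (simp add: j_def)
  moreover have "e \<noteq> T ! j" using e(2) j l by (auto simp: block_ends_def)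
  moreover have "T ! (k + 1) \<le> e \<or> e < T ! k + 1" if "k < \<tau>" "k \<noteq> h" for k
    using mono[of "k + 1" h] mono[of j k] that j h \<open>T ! h < e\<close> by (cases "k < h") auto
  ultimately show thesis using that[of h] j h by auto
qed

text \<open>
  One equation, at a torus point with nonzero coordinates, is enough.  Its real part is a sum of
  integers, except for the block that \<open>e\<close> would cut, which contributes
  the fraction \<open>\<Sum>\<^sub>i\<^sub>\<le>\<^sub>e y\<^sub>i\<^sup>2\<close> of the full sum of squares \<open>1\<close>.
\<close>

lemma block_end_if_truncation_regular:
  assumes T: "list_of_steps n \<tau> T" and N: "L 1 = of_real (- real N)" and e: "e \<le> n"
    and L: "linear L" "\<And>i. i \<in> {1..n} \<Longrightarrow> L (v i) = (if i \<le> e then - v i else 0)"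
    and J: "J \<in> torus v B T" and zero: "(\<Sum>w\<leftarrow>adapted_basis v T J. w * L w) = 0"
    and coords: "\<forall>h<\<tau>. J ! h = (\<Sum>i=T ! h + 1..T ! (h + 1). y h i *\<^sub>R v i) \<and>
      (\<Sum>i=T ! h + 1..T ! (h + 1). (y h i)\<^sup>2) = 1 \<and> (\<forall>i. y h i \<noteq> 0)"
  shows "e \<in> block_ends T"
proof (rule ccontr)
  have y: "\<And>h. h < \<tau> \<Longrightarrow> J ! h = (\<Sum>i=T ! h + 1..T ! (h + 1). y h i *\<^sub>R v i)"
    "\<And>h. h < \<tau> \<Longrightarrow> (\<Sum>i=T ! h + 1..T ! (h + 1). (y h i)\<^sup>2) = 1"
    "\<And>h i. h < \<tau> \<Longrightarrow> y h i \<noteq> 0"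
    using coords by blast+
  assume "e \<notin> block_ends T"
  then obtain h where h: "h < \<tau>" "T ! h < e" "e < T ! (h + 1)"
    "\<And>k. k < \<tau> \<Longrightarrow> k \<noteq> h \<Longrightarrow> T ! (k + 1) \<le> e \<or> e < T ! k + 1"
    using block_between[OF T e] by blast
  have l: "length T = \<tau> + 1" using T by (simp add: list_of_steps_def)
  \<comment> \<open>\<open>part k\<close> is the real part of the contribution of the \<open>k\<close>-th sphere.\<close>
  define part where "part k = (\<Sum>i=T ! k + 1..T ! (k + 1). if i \<le> e then (y k i)\<^sup>2 else 0)" for k
  have lin: "linear (star_trace c)"
    unfolding star_trace_def using star
    by (intro linear_compose_add) (auto simp: star_involution_def linear_ident)
  have c_real: "c (of_real a) = of_real a" for a
  proof -
    have "c (c 1) = c (1 * c 1)" by simp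
    also have "\<dots> = c (c 1) * c 1" using star unfolding star_involution_def by metis
    finally have "c 1 = 1" using star by (simp add: star_involution_def)
    then show ?thesis
      using star linear_scale[of c a 1] by (simp add: star_involution_def of_real_def)
  qed
  have L1_trace: "star_trace c (L 1) = of_real (2 * (- real N))"
    unfolding N star_trace_def c_real of_real_add[symmetric] by (simp only: mult_2)
  have single: "star_trace c (v i * L (v i)) = of_real (2 * (if i \<le> e then 1 else 0))"
    if "i \<in> {1..T ! 0}" for i
    using star_trace_truncation_block[OF L, of i i "v i" "\<lambda>_. 1"]
      that list_of_steps_le[OF T, of 0] l by simp
  have block: "star_trace c (J ! k * L (J ! k)) = of_real (2 * part k)" if "k < \<tau>" for k
    unfolding part_def
    by (rule star_trace_truncation_block[OF L _ _ y(1)[OF that]])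
      (use list_of_steps_le[OF T] l that in auto)
  have "0 = star_trace c (\<Sum>w\<leftarrow>adapted_basis v T J. w * L w)"
    by (simp add: zero linear_0[OF lin])
  also have "\<dots> = star_trace c (L 1) + (\<Sum>i=1..T ! 0. star_trace c (v i * L (v i)))
      + (\<Sum>k<\<tau>. star_trace c (J ! k * L (J ! k)))"
    by (simp add: sum_list_adapted_basis[OF torus_length[OF T J]] linear_add[OF lin] linear_sum[OF lin])
  also have "\<dots> = of_real (2 * (- real N)) + (\<Sum>i=1..T ! 0. of_real (2 * (if i \<le> e then 1 else 0)))
      + (\<Sum>k<\<tau>. of_real (2 * part k))"
    using single block by (simp add: L1_trace)
  also have "\<dots> = of_real (2 * (- real N + (\<Sum>i=1..T ! 0. if i \<le> e then 1 else 0) + (\<Sum>k<\<tau>. part k)))"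
    by (simp only: of_real_sum[symmetric] of_real_add[symmetric] sum_distrib_left distrib_left)
  finally have "- real N + (\<Sum>i=1..T ! 0. if i \<le> e then 1 else 0) + (\<Sum>k<\<tau>. part k) = 0"
    by (metis mult_eq_0_iff of_real_eq_0_iff zero_neq_numeral)
  moreover have "(\<Sum>k<\<tau>. part k) = part h + (\<Sum>k\<in>{..<\<tau>} - {h}. part k)"
    using h by (simp add: sum.remove)
  ultimately have "part h = real N - (\<Sum>i=1..T ! 0. if i \<le> e then 1 else 0)
      - (\<Sum>k\<in>{..<\<tau>} - {h}. part k)" by simp
  moreover have "part k \<in> \<int>" if "k \<in> {..<\<tau>} - {h}" for k
  proof (cases "T ! (k + 1) \<le> e")
    case True
    then have "part k = (\<Sum>i=T ! k + 1..T ! (k + 1). (y k i)\<^sup>2)"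
      unfolding part_def by (intro sum.cong) auto
    then show ?thesis using y(2) that by simp
  next
    case False
    then have "part k = 0" using h(4)[of k] that unfolding part_def by (intro sum.neutral) auto
    then show ?thesis by simp
  qed
  then have "(\<Sum>k\<in>{..<\<tau>} - {h}. part k) \<in> \<int>" by (rule Ints_sum)
  moreover have "(\<Sum>i=1..T ! 0. if i \<le> e then 1 else 0::real) \<in> \<int>"
    by (rule Ints_sum) auto
  ultimately have "part h \<in> \<int>" by simp
  \<comment> \<open>The index \<open>e\<close> belongs to the block and is kept; the last index of the block is left out.\<close>
  moreover have "0 < part h"
    unfolding part_def by (rule sum_pos2[of _ e]) (use h y(3) in auto)
  moreover have "part h < (\<Sum>i=T ! h + 1..T ! (h + 1). (y h i)\<^sup>2)"
    unfolding part_def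
    by (rule sum_strict_mono_ex1) (use h y(3) in \<open>auto intro!: bexI[of _ "T ! (h + 1)"]\<close>)
  ultimately show False using y(2)[OF h(1)] by (auto elim!: Ints_cases)
qed

text \<open>
  Testing with the truncation at \<open>e\<close> shows both that \<open>e\<close> remains a block end for \<open>T'\<close> and, since
  the value \<open>L 1\<close> serves both lists, that they have equally many blocks up to \<open>e\<close>.  For \<open>e = n\<close>
  this turns the inclusion of the sets of block ends into an equality.
\<close>

lemma block_ends_eq_if_Reg_subset:
  assumes T: "list_of_steps n \<tau> T" and T': "list_of_steps n \<tau>' T'"
    and \<Omega>: "openin (top_of_set (span (v ` {0..n}))) \<Omega>" "\<Omega> \<noteq> {}"
    and sub: "Reg v B T \<Omega> \<subseteq> Reg v B T' \<Omega>"
  shows "block_ends T = block_ends T'"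
proof -
  obtain p where p: "(\<Sum>i=0..n. p i *\<^sub>R v i) \<in> \<Omega>" "\<And>i. p i \<noteq> 0"
    using generic_point[OF \<Omega>] by blast
  obtain J y where J: "J \<in> torus v B T'"
    "(\<Sum>i=0..n. p i *\<^sub>R v i) \<in> span (set (adapted_basis v T' J))" and
    y: "\<forall>h<\<tau>'. J ! h = (\<Sum>i=T' ! h + 1..T' ! (h + 1). y h i *\<^sub>R v i) \<and>
      (\<Sum>i=T' ! h + 1..T' ! (h + 1). (y h i)\<^sup>2) = 1 \<and> (\<forall>i. y h i \<noteq> 0)"
    by (rule generic_torus_point[OF T', where p = p, OF p(2)])
  have slice: "slice v T' J \<Omega> \<noteq> {}" using p(1) J(2) by (auto simp: slice_def)
  have transfer: "e \<in> block_ends T' \<and> (e = n \<longrightarrow> block_count T n = block_count T' n)"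
    if e: "e \<in> block_ends T" for e
  proof -
    obtain L where L1: "L 1 = of_real (- real (block_count T e))"
      and L: "linear L" "\<And>i. i \<in> {1..n} \<Longrightarrow> L (v i) = (if i \<le> e then - v i else 0)"
      using truncation_exists by blast
    have "restrict L \<Omega> \<in> Reg v B T \<Omega>"
      using cr_truncation_adapted[OF T e _ L] L1
      by (simp add: restrict_linear_Reg_iff[OF T L(1) \<Omega>(1)])
    then have "restrict L \<Omega> \<in> Reg v B T' \<Omega>" using sub by blast
    then have zero: "(\<Sum>w\<leftarrow>adapted_basis v T' J. w * L w) = 0"
      using slice J(1) by (simp add: restrict_linear_Reg_iff[OF T' L(1) \<Omega>(1)])
    have "e \<le> n"
      using e list_of_steps_le[OF T, of 0] list_of_steps_le[OF T] T
      by (fastforce simp: block_ends_def list_of_steps_def in_set_conv_nth)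
    then have e': "e \<in> block_ends T'"
      using block_end_if_truncation_regular[OF T' L1 _ L J(1) zero y] by blast
    have "of_nat (block_count T e) = (of_nat (block_count T' e) :: 'a)"
      using cr_truncation_adapted[OF T' e' J(1) L] zero L1 by (simp add: eq_neg_iff_add_eq_0)
    then show ?thesis using e' by auto
  qed
  have "block_count T n = block_count T' n" using transfer last_mem_block_ends[OF T] by blast
  then have "card (block_ends T') = card (block_ends T)"
    using T T' by (simp add: card_block_ends[OF T] card_block_ends[OF T'] block_count_all[OF T]
        block_count_all[OF T']) (simp add: list_of_steps_def)
  moreover have "block_ends T \<subseteq> block_ends T'" using transfer by blast
  moreover have "finite (block_ends T')" by (simp add: block_ends_def)
  ultimately show ?thesis by (metis card_subset_eq)
qed

section \<open>Unit steps in front of a list\<close>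

text \<open>
  The points of the new torus are those of the old one with \<open>v\<^sub>k\<^sub>+\<^sub>1\<close> or \<open>- v\<^sub>k\<^sub>+\<^sub>1\<close> put in front,
  so an adapted basis for the longer list is one for the shorter list up to the sign of \<open>v\<^sub>k\<^sub>+\<^sub>1\<close>.
\<close>

lemma Reg_Cons_unit_step:
  assumes T: "T \<noteq> []" "T ! 0 = Suc k" "Suc k \<le> n"
  shows "Reg v B (k # T) \<Omega> = Reg v B T \<Omega>"
proof -
  define P where "P ws f \<longleftrightarrow> C1_on ws (\<Omega> \<inter> span (set ws)) f \<and>
    (\<forall>x\<in>\<Omega> \<inter> span (set ws). cr_operator ws f x = 0)" for ws :: "'a list" and f
  have Reg: "Reg v B S \<Omega> = {f \<in> \<Omega> \<rightarrow>\<^sub>E UNIV. \<forall>J\<in>torus v B S. P (adapted_basis v S J) f}" for S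
    by (simp add: Reg_def P_def slice_def)
  have sphere: "coord_sphere v B (Suc k) (T ! 0) = {v (Suc k), - v (Suc k)}"
    using coord_sphere_singleton[OF T(3)] T(2) by simp
  have torus: "torus v B (k # T) = {w # J | w J. w \<in> {v (Suc k), - v (Suc k)} \<and> J \<in> torus v B T}"
  proof (intro set_eqI iffI)
    fix K assume K: "K \<in> torus v B (k # T)"
    then obtain w J where wJ: "K = w # J"
      using T(1) by (cases K) (auto simp: torus_def)
    have "w \<in> {v (Suc k), - v (Suc k)}"
      using K sphere unfolding torus_def wJ by (auto dest: spec[of _ 0])
    moreover have "J ! h \<in> coord_sphere v B (T ! h + 1) (T ! (h + 1))" if "h < length J" for h
      using K that unfolding torus_def wJ by (auto dest: spec[of _ "Suc h"])
    then have "J \<in> torus v B T"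
      using K T(1) unfolding torus_def wJ by auto
    ultimately show "K \<in> {w # J | w J. w \<in> {v (Suc k), - v (Suc k)} \<and> J \<in> torus v B T}"
      using wJ by blast
  next
    fix K assume "K \<in> {w # J | w J. w \<in> {v (Suc k), - v (Suc k)} \<and> J \<in> torus v B T}"
    then obtain w J where wJ: "K = w # J" "w \<in> coord_sphere v B (Suc k) (T ! 0)" "J \<in> torus v B T"
      unfolding sphere by blast
    then show "K \<in> torus v B (k # T)"
      using T(1) by (auto simp: torus_def nth_Cons split: nat.splits)
  qed
  have flip: "P (adapted_basis v (k # T) (w # J)) f \<longleftrightarrow> P (adapted_basis v T J) f"
    if "w \<in> {v (Suc k), - v (Suc k)}" for w J f
  proof -
    have "adapted_basis v (k # T) (w # J) = map v [0..<Suc k] @ w # J"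
      "adapted_basis v T J = map v [0..<Suc k] @ v (Suc k) # J"
      by (simp_all add: adapted_basis_def T(2))
    then show ?thesis
      using that regular_on_negate[of "map v [0..<Suc k]" "v (Suc k)" J] unfolding P_def by auto
  qed
  have "(\<forall>K\<in>torus v B (k # T). P (adapted_basis v (k # T) K) f) \<longleftrightarrow>
    (\<forall>J\<in>torus v B T. P (adapted_basis v T J) f)" for f
  proof (intro iffI ballI)
    fix J assume all: "\<forall>K\<in>torus v B (k # T). P (adapted_basis v (k # T) K) f" and J: "J \<in> torus v B T"
    from J have "v (Suc k) # J \<in> torus v B (k # T)" by (simp add: torus)
    with all have "P (adapted_basis v (k # T) (v (Suc k) # J)) f" by (rule bspec)
    then show "P (adapted_basis v T J) f" by (simp add: flip)
  next
    fix K assume all: "\<forall>J\<in>torus v B T. P (adapted_basis v T J) f" and "K \<in> torus v B (k # T)"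
    then obtain w J where K: "K = w # J" "w \<in> {v (Suc k), - v (Suc k)}" "J \<in> torus v B T"
      unfolding torus by blast
    from all K(3) have "P (adapted_basis v T J) f" by (rule bspec)
    then show "P (adapted_basis v (k # T) K) f" unfolding K(1) flip[OF K(2)] .
  qed
  then show ?thesis unfolding Reg by simp
qed

lemma Reg_unit_steps:
  assumes T: "T \<noteq> []" "T ! 0 \<le> n" and k: "k \<le> T ! 0"
  shows "Reg v B ([k..<T ! 0] @ T) \<Omega> = Reg v B T \<Omega>"
  using k
proof (induction k rule: inc_induct)
  case (step k)
  have "([Suc k..<T ! 0] @ T) ! 0 = Suc k"
    using step(2) by (cases "Suc k < T ! 0") (auto simp: nth_append)
  then have "Reg v B (k # [Suc k..<T ! 0] @ T) \<Omega> = Reg v B ([Suc k..<T ! 0] @ T) \<Omega>"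
    using step(2) T by (intro Reg_Cons_unit_step) auto
  then show ?case using step by (simp add: upt_conv_Cons)
qed simp

end

section \<open>Inclusion, equality and the shape of the lists\<close>

theorem corollary5p18:
  fixes c :: "'a::{real_algebra_1, euclidean_space} \<Rightarrow> 'a"
    and V B \<Omega> :: "'a set"
    and v :: "nat \<Rightarrow> 'a"
    and n \<tau> \<tau>' :: nat
    and T T' :: "nat list"
  assumes "star_involution c"
    and "imag_units c \<noteq> {}"
    and "hypercomplex_subspace c V"
    and "hypercomplex_basis c V n v"
    and "completes_basis n v B"
    and "\<tau> \<in> {0..n}" and "\<tau>' \<in> {0..n}"
    and "list_of_steps n \<tau> T" and "list_of_steps n \<tau>' T'"
    and "domain_in V \<Omega>"
  shows "(Reg v B T \<Omega> \<subseteq> Reg v B T' \<Omega> \<longleftrightarrow> Reg v B T \<Omega> = Reg v B T' \<Omega>) \<and>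
         (Reg v B T \<Omega> \<subseteq> Reg v B T' \<Omega> \<longleftrightarrow>
            (T' ! 0 \<le> T ! 0 \<and> T' = [T' ! 0..<T ! 0] @ T) \<or>
            (T ! 0 \<le> T' ! 0 \<and> T = [T ! 0..<T' ! 0] @ T'))"
proof -
  note T = \<open>list_of_steps n \<tau> T\<close> and T' = \<open>list_of_steps n \<tau>' T'\<close>
  have V: "V = span (v ` {0..n})"
    using \<open>hypercomplex_basis c V n v\<close> by (simp add: hypercomplex_basis_def)
  interpret imaginary_frame c v n B
    using assms(1,4,5) unfolding V by unfold_locales
  have ne: "T \<noteq> []" "T' \<noteq> []" and le: "T ! 0 \<le> n" "T' ! 0 \<le> n"
    using T T' list_of_steps_le[of n _ _ 0] by (auto simp: list_of_steps_def)
  let ?related = "(T' ! 0 \<le> T ! 0 \<and> T' = [T' ! 0..<T ! 0] @ T) \<or>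
    (T ! 0 \<le> T' ! 0 \<and> T = [T ! 0..<T' ! 0] @ T')"
  have "?related" if "Reg v B T \<Omega> \<subseteq> Reg v B T' \<Omega>"
  proof -
    have eq: "block_ends T = block_ends T'"
      using block_ends_eq_if_Reg_subset[OF T T' _ _ that] \<open>domain_in V \<Omega>\<close>
      by (simp add: domain_in_def V)
    then show ?thesis
      using block_ends_eq_imp_prefix[OF T T' eq] block_ends_eq_imp_prefix[OF T' T eq[symmetric]]
      by (meson nle_le)
  qed
  moreover have "Reg v B T \<Omega> = Reg v B T' \<Omega>" if ?related
    using that Reg_unit_steps[OF ne(1) le(1), of "T' ! 0" \<Omega>]
      Reg_unit_steps[OF ne(2) le(2), of "T ! 0" \<Omega>] by metis
  ultimately show ?thesis by blast
qed

end
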